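(* Let $U:\mathbb{R}\to\mathbb{R}$ be a periodic continuous function, and let $\alpha,\beta:\mathbb{R}\to\mathbb{R}$ be periodic functions that are Hölder continuous with exponent $r\in(0,1]$. Let $$H(x,t)=U(t)\sin\big(2\pi(x_1+\alpha(t))\big)\sin\big(2\pi(x_2+\beta(t))\big),\qquad V(x,t)=\big(-H_{x_2}(x,t),\,H_{x_1}(x,t)\big),$$ for $x=(x_1,x_2)\in\mathbb{R}^2$, $t\in\mathbb{R}$. For $A>1$, let $s_{\rm T}(p,A)$ be the turbulent flame speed corresponding to the flow $AV$. Then $$s_{\rm T}(p,A)\le\frac{CA}{\log A}$$ for any unit vector $p\in\mathbb{R}^2$, where (for fixed $r$) $C$ is a constant depending only on $\|U\|_{C^0(\mathbb{R})}$, $\|\alpha\|_{C^{0,r}(\mathbb{R})}$ and $\|\beta\|_{C^{0,r}(\mathbb{R})}$.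
   Context: Turbulent flame speed for a time-dependent flow: for a unit vector $p\in\mathbb{R}^2$ and $A>0$, let $G(x,t)$ be the unique viscosity solution on $\mathbb{R}^2\times[0,\infty)$ of the (inviscid) G-equation $$G_t+A V(x,t)\cdot DG+|DG|=0,\qquad G(x,0)=p\cdot x .$$ Then $s_{\rm T}(p,A):=\lim_{t\to+\infty}-\dfrac{G(x,t)}{t}$, the limit being understood to exist locally uniformly in $x$ and to be independent of $x$. *)

theory Defs
  imports "HOL-Analysis.Analysis" "HOL-Library.Periodic_Fun"
begin

section \<open>Viscosity solutions of the G-equation\<close>

text \<open>
  Points of space-time are pairs \<open>(x, t)\<close> with \<open>x\<close> in the plane.  The gradient of a test function
  is a pair as well: its first component is the spatial gradient, its second one the time derivative.
\<close>

type_synonym spacetime = "(real^2) \<times> real"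

definition C1_on :: "spacetime set \<Rightarrow> (spacetime \<Rightarrow> real) \<Rightarrow> (spacetime \<Rightarrow> spacetime) \<Rightarrow> bool" where
  "C1_on S \<phi> D\<phi> \<longleftrightarrow> (\<forall>z\<in>S. GDERIV \<phi> z :> D\<phi> z) \<and> continuous_on S D\<phi>"

definition local_max_at :: "(spacetime \<Rightarrow> real) \<Rightarrow> spacetime \<Rightarrow> bool" where
  "local_max_at f z \<longleftrightarrow> (\<forall>\<^sub>F w in nhds z. f w \<le> f z)"

definition local_min_at :: "(spacetime \<Rightarrow> real) \<Rightarrow> spacetime \<Rightarrow> bool" where
  "local_min_at f z \<longleftrightarrow> (\<forall>\<^sub>F w in nhds z. f z \<le> f w)"

text \<open>
  The value at \<open>(x, t)\<close> of \<open>\<phi>\<^sub>t + A V(x,t) \<bullet> D\<phi> + |D\<phi>|\<close>, where \<open>q = (D\<phi>, \<phi>\<^sub>t)\<close>.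
\<close>

definition G_operator ::
    "(real^2 \<Rightarrow> real \<Rightarrow> real^2) \<Rightarrow> real \<Rightarrow> spacetime \<Rightarrow> spacetime \<Rightarrow> real" where
  "G_operator V A = (\<lambda>(x, t) q. snd q + A * (V x t \<bullet> fst q) + norm (fst q))"

definition viscosity_subsolution ::
    "(real^2 \<Rightarrow> real \<Rightarrow> real^2) \<Rightarrow> real \<Rightarrow> (spacetime \<Rightarrow> real) \<Rightarrow> bool" where
  "viscosity_subsolution V A G \<longleftrightarrow>
     (\<forall>\<phi> D\<phi>. \<forall>z\<in>UNIV \<times> {0<..}. C1_on (UNIV \<times> {0<..}) \<phi> D\<phi> \<longrightarrow>
        local_max_at (\<lambda>w. G w - \<phi> w) z \<longrightarrow> G_operator V A z (D\<phi> z) \<le> 0)"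

definition viscosity_supersolution ::
    "(real^2 \<Rightarrow> real \<Rightarrow> real^2) \<Rightarrow> real \<Rightarrow> (spacetime \<Rightarrow> real) \<Rightarrow> bool" where
  "viscosity_supersolution V A G \<longleftrightarrow>
     (\<forall>\<phi> D\<phi>. \<forall>z\<in>UNIV \<times> {0<..}. C1_on (UNIV \<times> {0<..}) \<phi> D\<phi> \<longrightarrow>
        local_min_at (\<lambda>w. G w - \<phi> w) z \<longrightarrow> G_operator V A z (D\<phi> z) \<ge> 0)"

text \<open>Values of \<open>G\<close> at negative times play no role.\<close>

definition solves_G_equation ::
    "(real^2 \<Rightarrow> real \<Rightarrow> real^2) \<Rightarrow> real \<Rightarrow> real^2 \<Rightarrow> (spacetime \<Rightarrow> real) \<Rightarrow> bool" where
  "solves_G_equation V A p G \<longleftrightarrow>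
     continuous_on (UNIV \<times> {0..}) G \<and>
     viscosity_subsolution V A G \<and> viscosity_supersolution V A G \<and>
     (\<forall>x. G (x, 0) = p \<bullet> x)"

text \<open>
  \<open>is_turbulent_flame_speed V A p s\<close> says that \<open>s\<^sub>T(p, A)\<close> exists for the flow \<open>A V\<close> and equals \<open>s\<close>.
\<close>

definition is_turbulent_flame_speed ::
    "(real^2 \<Rightarrow> real \<Rightarrow> real^2) \<Rightarrow> real \<Rightarrow> real^2 \<Rightarrow> real \<Rightarrow> bool" where
  "is_turbulent_flame_speed V A p s \<longleftrightarrow>
     (\<exists>G. solves_G_equation V A p G \<and>
        (\<forall>K. compact K \<longrightarrow> uniform_limit K (\<lambda>t x. - G (x, t) / t) (\<lambda>_. s) at_top))"

section \<open>The moving cellular flow\<close>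

definition cellular_stream ::
    "(real \<Rightarrow> real) \<Rightarrow> (real \<Rightarrow> real) \<Rightarrow> (real \<Rightarrow> real) \<Rightarrow> real^2 \<Rightarrow> real \<Rightarrow> real" where
  "cellular_stream U \<alpha> \<beta> x t =
     U t * sin (2 * pi * (x $ 1 + \<alpha> t)) * sin (2 * pi * (x $ 2 + \<beta> t))"

definition partial_deriv :: "2 \<Rightarrow> (real^2 \<Rightarrow> real) \<Rightarrow> real^2 \<Rightarrow> real" where
  "partial_deriv i f x = frechet_derivative f (at x) (axis i 1)"

definition stream_flow :: "(real^2 \<Rightarrow> real \<Rightarrow> real) \<Rightarrow> real^2 \<Rightarrow> real \<Rightarrow> real^2" where
  "stream_flow H x t =
     vector [- partial_deriv 2 (\<lambda>y. H y t) x, partial_deriv 1 (\<lambda>y. H y t) x]"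

section \<open>Periodic and Hoelder continuous functions of one variable\<close>

definition periodic :: "(real \<Rightarrow> real) \<Rightarrow> bool" where
  "periodic f \<longleftrightarrow> (\<exists>T>0. periodic_fun_simple f T)"

definition holder_continuous :: "real \<Rightarrow> (real \<Rightarrow> real) \<Rightarrow> bool" where
  "holder_continuous r f \<longleftrightarrow> (\<exists>K. \<forall>s t. \<bar>f s - f t\<bar> \<le> K * \<bar>s - t\<bar> powr r)"

text \<open>
  The suprema below are suprema of real sets; they are meaningful for bounded functions and, in the
  case of the seminorm, for Hoelder continuous ones.
\<close>

definition C0_norm :: "(real \<Rightarrow> real) \<Rightarrow> real" where
  "C0_norm f = (SUP t. \<bar>f t\<bar>)"

definition holder_seminorm :: "real \<Rightarrow> (real \<Rightarrow> real) \<Rightarrow> real" where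
  "holder_seminorm r f = (SUP (s, t)\<in>{(s, t). s \<noteq> t}. \<bar>f s - f t\<bar> / \<bar>s - t\<bar> powr r)"

definition holder_norm :: "real \<Rightarrow> (real \<Rightarrow> real) \<Rightarrow> real" where
  "holder_norm r f = C0_norm f + holder_seminorm r f"

end

theory Submission
  imports Defs
begin

text \<open>
  The value \<open>- G (x, t)\<close> measures how far in direction \<open>- p\<close> a particle ending at \<open>x\<close> at time \<open>t\<close> can have started,
  if it is carried by \<open>A V\<close> and may in addition move with unit speed.  The bound says that such a
  particle needs a time of order at least \<open>ln A / A\<close> to pass a cell.

  The reason is that the first component of \<open>V\<close> is at most a constant times
  \<open>|sin (2 \<pi> (x\<^sub>1 + \<alpha> t))|\<close>, whatever \<open>x\<^sub>2\<close> is, and likewise for the second component and \<open>\<beta>\<close>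
  (\<open>cellular_flow_component_le\<close>).  The sides of a cell are therefore crossed only by means of the unit speed and of
  the motion of the cell itself.  If the shifts are averaged over a time \<open>1 / A\<close>, this effective
  crossing speed is \<open>O(A powr (1 - r))\<close> (\<open>steklov_mean\<close>).  The distance \<open>y\<close> from a side then grows at most like
  \<open>y' \<le> D (A powr (1 - r) + 2 \<pi> A y)\<close>, and to reach \<open>y = 1\<close> takes a time of order \<open>r ln A / A\<close>.

  Measuring each coordinate by this travel time \<open>g\<close> (\<open>travel_time_profile\<close>) turns the argument into an
  explicit function
  \<open>w = \<Sum>\<^sub>i p\<^sub>i g (x\<^sub>i + m\<^sub>i t) / \<kappa> - \<sigma> t - c\<close>, where \<open>m\<^sub>i\<close> are the averaged shifts and \<open>\<kappa> = g 1 - g 0\<close>.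
  It is a continuously differentiable subsolution for \<open>\<sigma> = 2 D / \<kappa>\<close>
  (\<open>relative_speed_times_profile_le\<close>) and differs from \<open>p \<bullet> x - \<sigma> t\<close> by a bounded function.  Hence
  \<open>G \<ge> w\<close> (\<open>comparison_with_classical_subsolution\<close>), and dividing by \<open>t\<close> gives
  \<open>s\<^sub>T \<le> \<sigma> \<le> 4 \<pi> D A / (r ln A)\<close>.
\<close>

section \<open>Comparison with classical subsolutions\<close>

text \<open>
  In the gradient variable the Hamiltonian is Lipschitz with constant \<open>L = A N + 1\<close>, so information
  travels with speed at most \<open>L\<close> and the comparison is local in space, whatever the growth of \<open>G\<close> and \<open>w\<close>.
  Concretely, an increasing function of \<open>\<rho> = sqrt (1 + |x - x0|\<^sup>2) + L t\<close> can be subtracted from \<open>w\<close>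
  without losing the subsolution property.  A penalty that vanishes on the backward cone of
  \<open>(x0, t0)\<close> and exceeds \<open>|G - w|\<close> on the level set \<open>\<rho> = 2 + L t0\<close> keeps a negative minimum of the
  penalised difference inside the compact set \<open>\<rho> \<le> 2 + L t0\<close>, \<open>t \<ge> 0\<close>.  It also closes the domain at late times, since \<open>\<rho>\<close> grows with \<open>t\<close>.
\<close>

lemma comparison_with_classical_subsolution:
  assumes A: "0 \<le> A" and V: "\<And>x t. norm (V x t) \<le> N"
    and G: "continuous_on (UNIV \<times> {0..}) G" "viscosity_supersolution V A G"
    and w: "C1_on (UNIV \<times> {0<..}) w Dw" "continuous_on (UNIV \<times> {0..}) w"
    and sub: "\<And>z. z \<in> UNIV \<times> {0<..} \<Longrightarrow> G_operator V A z (Dw z) \<le> 0"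
    and init: "\<And>x. w (x, 0) \<le> G (x, 0)" and t0: "0 \<le> t0"
  shows "w (x0, t0) \<le> G (x0, t0)"
proof -
  define L where "L = A * N + 1"
  have "0 \<le> N" using V[of 0 0] norm_ge_zero order_trans by blast
  then have L: "1 \<le> L" using A by (simp add: L_def)
  define \<rho> :: "spacetime \<Rightarrow> real"
    where "\<rho> z = sqrt (1 + (fst z - x0) \<bullet> (fst z - x0)) + L * snd z" for z
  define \<rho>0 where "\<rho>0 = 1 + L * t0"
  \<comment> \<open>the spatial gradient of \<open>\<rho>\<close>\<close>
  define n where "n z = (1 / sqrt (1 + (fst z - x0) \<bullet> (fst z - x0))) *\<^sub>R (fst z - x0)" for z :: spacetime
  define b' where "b' \<rho> = 2 * max 0 (\<rho> - \<rho>0)" for \<rho> :: real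
  have pos: "0 < 1 + (x::real^2) \<bullet> x" for x by (simp add: add_pos_nonneg)
  have norm_n: "norm (n z) \<le> 1" for z
  proof -
    have "norm (fst z - x0) \<le> sqrt (1 + (fst z - x0) \<bullet> (fst z - x0))"
      by (simp add: norm_eq_sqrt_inner)
    then show ?thesis using pos[of "fst z - x0"] by (simp add: n_def divide_simps)
  qed
  have cont_\<rho>: "continuous_on X \<rho>" for X unfolding \<rho>_def by (intro continuous_intros)
  have cont_n: "continuous_on X n" for X
    unfolding n_def using pos by (intro continuous_intros) (simp add: less_imp_neq[symmetric])
  have d\<rho>: "GDERIV \<rho> z :> (n z, L)" for z
  proof -
    have "(\<rho> has_derivative (\<lambda>h. (2 * (fst h \<bullet> (fst z - x0))) / (2 * sqrt (1 + (fst z - x0) \<bullet> (fst z - x0))) + L * snd h)) (at z)"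
      unfolding \<rho>_def
      by (rule derivative_eq_intros refl | use pos[of "fst z - x0"] in force)+
         (auto simp: inner_commute divide_simps)
    then show ?thesis
      unfolding gderiv_def n_def by (simp add: inner_prod_def divide_simps mult.commute)
  qed
  \<comment> \<open>The positive part is squared because test functions have to be continuously differentiable.\<close>
  have db: "((\<lambda>s. (max 0 (s - \<rho>0))\<^sup>2) has_real_derivative b' s) (at s)" for s
  proof -
    consider "s < \<rho>0" | "s = \<rho>0" | "s > \<rho>0" by linarith
    then show ?thesis
    proof cases
      case 1
      have "((\<lambda>s. 0) has_real_derivative b' s) (at s)" using 1 by (simp add: b'_def)
      then show ?thesis
        by (rule has_field_derivative_transform_within_open[where S = "{..<\<rho>0}"]) (use 1 in auto)
    next
      case 3
      have "((\<lambda>s. (s - \<rho>0)\<^sup>2) has_real_derivative b' s) (at s)"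
        using 3 by (auto intro!: derivative_eq_intros simp: b'_def)
      then show ?thesis
        by (rule has_field_derivative_transform_within_open[where S = "{\<rho>0<..}"]) (use 3 in auto)
    next
      case 2
      have "((\<lambda>y. ((max 0 (y - s))\<^sup>2 - 0) / (y - s)) \<longlongrightarrow> 0) (at s)"
      proof (rule Lim_null_comparison)
        show "\<forall>\<^sub>F y in at s. norm (((max 0 (y - s))\<^sup>2 - 0) / (y - s)) \<le> \<bar>y - s\<bar>"
          by (intro always_eventually) (auto simp: max_def power2_eq_square)
        show "((\<lambda>y. \<bar>y - s\<bar>) \<longlongrightarrow> 0) (at s)" by (auto intro!: tendsto_eq_intros)
      qed
      then show ?thesis using 2 by (simp add: has_field_derivative_iff b'_def)
    qed
  qed
  \<comment> \<open>The term \<open>\<epsilon> t\<close> makes the subsolution strict.\<close>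
  have main: "w (x0, t0) - \<epsilon> * t0 \<le> G (x0, t0)" if \<epsilon>: "0 < \<epsilon>" for \<epsilon>
  proof -
    define S where "S = {z. 0 \<le> snd z \<and> \<rho> z \<le> \<rho>0 + 1}"
    have S_sub: "S \<subseteq> UNIV \<times> {0..}" by (auto simp: S_def)
    have \<rho>ge: "norm (fst z - x0) + snd z \<le> \<rho> z" if "0 \<le> snd z" for z
    proof -
      have "norm (fst z - x0) \<le> sqrt (1 + (fst z - x0) \<bullet> (fst z - x0))"
        by (simp add: norm_eq_sqrt_inner)
      moreover have "snd z \<le> L * snd z" using L that by (simp add: mult_le_cancel_right1)
      ultimately show ?thesis by (simp add: \<rho>_def)
    qed
    have "S \<subseteq> cball x0 (\<rho>0 + 1) \<times> {0..\<rho>0 + 1}"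
    proof
      fix z assume "z \<in> S"
      then have z: "0 \<le> snd z" "\<rho> z \<le> \<rho>0 + 1" by (auto simp: S_def)
      have "norm (fst z - x0) \<le> \<rho>0 + 1" "snd z \<le> \<rho>0 + 1"
        using \<rho>ge[OF z(1)] z norm_ge_zero[of "fst z - x0"] by linarith+
      then show "z \<in> cball x0 (\<rho>0 + 1) \<times> {0..\<rho>0 + 1}"
        using z(1) by (cases z) (auto simp: dist_norm norm_minus_commute)
    qed
    moreover have "bounded (cball x0 (\<rho>0 + 1) \<times> {0..\<rho>0 + 1})"
      by (intro bounded_Times bounded_cball bounded_closed_interval)
    moreover have "closed S"
      unfolding S_def
      by (intro closed_Collect_conj closed_Collect_le continuous_intros cont_\<rho>)
    ultimately have compS: "compact S" by (meson bounded_subset compact_eq_bounded_closed)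
    have z0S: "(x0, t0) \<in> S" using t0 by (simp add: S_def \<rho>_def \<rho>0_def)
    define F where "F z = G z - w z + \<epsilon> * snd z" for z
    have contF: "continuous_on S F"
      unfolding F_def
      by (intro continuous_intros continuous_on_subset[OF G(1) S_sub] continuous_on_subset[OF w(2) S_sub])
    obtain M where M: "\<And>z. z \<in> S \<Longrightarrow> \<bar>F z\<bar> \<le> M"
      using compact_imp_bounded[OF compact_continuous_image[OF contF compS]]
      by (auto simp: bounded_iff)
    have M0: "0 \<le> M" using M[OF z0S] by linarith
    define \<phi> where "\<phi> z = w z - \<epsilon> * snd z - (M + 1) * (max 0 (\<rho> z - \<rho>0))\<^sup>2" for z
    define D\<phi> where "D\<phi> z = Dw z - (0, \<epsilon>) - ((M + 1) * b' (\<rho> z)) *\<^sub>R (n z, L)" for z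
    have dist_\<phi>: "G z - \<phi> z = F z + (M + 1) * (max 0 (\<rho> z - \<rho>0))\<^sup>2" for z
      by (simp add: \<phi>_def F_def)
    have "GDERIV \<phi> z :> D\<phi> z" if "z \<in> UNIV \<times> {0<..}" for z
    proof -
      have 1: "GDERIV w z :> Dw z" using w(1) that by (auto simp: C1_on_def)
      have 2: "GDERIV (\<lambda>z. (max 0 (\<rho> z - \<rho>0))\<^sup>2) z :> b' (\<rho> z) *\<^sub>R (n z, L)"
        using GDERIV_DERIV_compose[OF d\<rho> db] by simp
      have "(\<phi> has_derivative (\<lambda>h. h \<bullet> Dw z - \<epsilon> * snd h - (M + 1) * (h \<bullet> (b' (\<rho> z) *\<^sub>R (n z, L))))) (at z)"
        using 1 2 unfolding \<phi>_def gderiv_def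
        by (intro has_derivative_diff has_derivative_mult_right has_derivative_snd has_derivative_ident)
      then show ?thesis
        unfolding gderiv_def D\<phi>_def
        by (simp add: inner_diff_right inner_prod_def algebra_simps)
    qed
    moreover have "continuous_on (UNIV \<times> {0<..}) D\<phi>"
    proof -
      have "continuous_on (UNIV \<times> {0<..}) Dw" using w(1) by (simp add: C1_on_def)
      then show ?thesis unfolding D\<phi>_def b'_def by (intro continuous_intros cont_\<rho> cont_n)
    qed
    ultimately have C1: "C1_on (UNIV \<times> {0<..}) \<phi> D\<phi>" by (simp add: C1_on_def)
    have "0 \<le> G (x0, t0) - \<phi> (x0, t0)"
    proof (rule ccontr)
      assume neg: "\<not> 0 \<le> G (x0, t0) - \<phi> (x0, t0)"
      have "continuous_on S (\<lambda>z. G z - \<phi> z)"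
        unfolding dist_\<phi> by (intro continuous_intros contF cont_\<rho>)
      then obtain z where z: "z \<in> S" and zmin: "\<And>y. y \<in> S \<Longrightarrow> G z - \<phi> z \<le> G y - \<phi> y"
        using continuous_attains_inf[OF compS] z0S by blast
      have zneg: "G z - \<phi> z < 0" using zmin[OF z0S] neg by linarith
      have "snd z \<noteq> 0"
      proof
        assume s: "snd z = 0"
        have "0 \<le> F z" using init[of "fst z"] s by (cases z) (simp add: F_def)
        then show False using zneg dist_\<phi>[of z] M0
          by (smt (verit) mult_nonneg_nonneg zero_le_power2)
      qed
      then have t: "0 < snd z" using z by (auto simp: S_def)
      have "\<rho> z \<noteq> \<rho>0 + 1"
      proof
        assume "\<rho> z = \<rho>0 + 1"
        then show False using zneg dist_\<phi>[of z] M[OF z] by simp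
      qed
      then have \<rho>z: "\<rho> z < \<rho>0 + 1" using z by (auto simp: S_def)
      have "open {y. 0 < snd y \<and> \<rho> y < \<rho>0 + 1}"
        by (intro open_Collect_conj open_Collect_less continuous_intros cont_\<rho>)
      then have "\<forall>\<^sub>F y in nhds z. 0 < snd y \<and> \<rho> y < \<rho>0 + 1"
        using t \<rho>z by (auto dest: eventually_nhds_in_open[where x = z])
      then have "local_min_at (\<lambda>w. G w - \<phi> w) z"
        unfolding local_min_at_def by eventually_elim (rule zmin, simp add: S_def)
      moreover have zin: "z \<in> UNIV \<times> {0<..}" using t by (cases z) auto
      ultimately have "0 \<le> G_operator V A z (D\<phi> z)"
        using G(2) C1 unfolding viscosity_supersolution_def by blast
      moreover have "G_operator V A z (D\<phi> z) < 0"
      proof -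
        obtain x t where zxt: "z = (x, t)" by (cases z)
        define \<mu> where "\<mu> = (M + 1) * b' (\<rho> z)"
        have \<mu>: "0 \<le> \<mu>" using M0 by (simp add: \<mu>_def b'_def)
        have D: "D\<phi> z = (fst (Dw z) - \<mu> *\<^sub>R n z, snd (Dw z) - \<epsilon> - \<mu> * L)"
          by (simp add: D\<phi>_def \<mu>_def minus_prod_def)
        \<comment> \<open>The penalty contributes at most \<open>\<mu> (A N + 1 - L) = 0\<close>, which leaves \<open>- \<epsilon>\<close>.\<close>
        have "\<bar>V x t \<bullet> n z\<bar> \<le> norm (V x t) * norm (n z)" by (rule Cauchy_Schwarz_ineq2)
        also have "\<dots> \<le> N * 1" using V norm_n \<open>0 \<le> N\<close> by (intro mult_mono) auto
        finally have "- (V x t \<bullet> n z) \<le> N" by simp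
        then have "A * - (V x t \<bullet> n z) \<le> A * N" using A by (rule mult_left_mono)
        then have "\<mu> * (A * - (V x t \<bullet> n z)) \<le> \<mu> * (A * N)" using \<mu> by (rule mult_left_mono)
        moreover have "norm (fst (Dw z) - \<mu> *\<^sub>R n z) \<le> norm (fst (Dw z)) + \<mu>"
        proof -
          have "\<mu> * norm (n z) \<le> \<mu> * 1" using \<mu> norm_n by (intro mult_left_mono)
          then show ?thesis using norm_triangle_ineq4[of "fst (Dw z)" "\<mu> *\<^sub>R n z"] \<mu> by simp
        qed
        ultimately show ?thesis
          using sub[OF zin] \<epsilon> unfolding D unfolding zxt
          by (simp add: G_operator_def inner_diff_right L_def algebra_simps)
      qed
      ultimately show False by simp
    qed
    then show ?thesis by (simp add: \<phi>_def \<rho>_def \<rho>0_def)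
  qed
  show ?thesis
  proof (rule field_le_epsilon)
    fix e :: real assume e: "0 < e"
    have "(e / (t0 + 1)) * t0 \<le> e" using t0 e by (simp add: field_simps)
    then show "w (x0, t0) \<le> G (x0, t0) + e" using main[of "e / (t0 + 1)"] t0 e by simp
  qed
qed

section \<open>Periodic and Hoelder continuous functions\<close>

lemma antiderivative_ex:
  fixes f :: "real \<Rightarrow> real"
  assumes "continuous_on UNIV f"
  obtains F where "\<And>x. (F has_real_derivative f x) (at x)"
proof -
  have "isCont f x" for x using assms by (simp add: continuous_on_eq_continuous_at)
  then show ?thesis
    using einterval_antiderivative[of "-\<infinity>" \<infinity> f] that
    by (auto simp: has_real_derivative_iff_has_vector_derivative)
qed

lemma periodic_continuous_bounded:
  assumes "periodic f" "continuous_on UNIV f"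
  obtains B where "\<And>t. \<bar>f t\<bar> \<le> B"
proof -
  obtain T where T: "0 < T" "periodic_fun_simple f T" using assms(1) by (auto simp: periodic_def)
  interpret periodic_fun_simple f T by (fact T(2))
  have "bounded (f ` {0..T})"
    by (intro compact_imp_bounded compact_continuous_image continuous_on_subset[OF assms(2)]) auto
  then obtain B where B: "\<And>t. t \<in> {0..T} \<Longrightarrow> \<bar>f t\<bar> \<le> B" unfolding bounded_iff by fastforce
  have "\<bar>f t\<bar> \<le> B" for t
  proof -
    have "f t = f (t - of_int \<lfloor>t / T\<rfloor> * T)" by (simp add: minus_of_int)
    moreover have "of_int \<lfloor>t / T\<rfloor> * T \<le> t" "t < (of_int \<lfloor>t / T\<rfloor> + 1) * T"
      using T(1) floor_divide_lower[of T t] floor_divide_upper[of T t] by simp_all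
    ultimately show ?thesis using B[of "t - of_int \<lfloor>t / T\<rfloor> * T"] by (simp add: algebra_simps)
  qed
  then show ?thesis by (rule that)
qed

lemma abs_le_C0_norm:
  assumes "periodic f" "continuous_on UNIV f"
  shows "\<bar>f t\<bar> \<le> C0_norm f"
proof -
  obtain B where "\<And>t. \<bar>f t\<bar> \<le> B" using periodic_continuous_bounded[OF assms] by blast
  then show ?thesis unfolding C0_norm_def by (intro cSUP_upper bdd_aboveI2) auto
qed

lemma holder_continuous_imp_continuous:
  assumes "0 < r" "holder_continuous r f"
  shows "continuous_on UNIV f"
proof -
  obtain K where K: "\<And>s t. \<bar>f s - f t\<bar> \<le> K * \<bar>s - t\<bar> powr r"
    using assms(2) by (auto simp: holder_continuous_def)
  have "(f \<longlongrightarrow> f t) (at t)" for t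
  proof -
    have "((\<lambda>s. K * \<bar>s - t\<bar> powr r) \<longlongrightarrow> K * \<bar>t - t\<bar> powr r) (at t)"
      using assms(1) by (intro tendsto_intros tendsto_powr2) (auto intro!: always_eventually tendsto_intros)
    then have "((\<lambda>s. K * \<bar>s - t\<bar> powr r) \<longlongrightarrow> 0) (at t)" by simp
    then have "((\<lambda>s. f s - f t) \<longlongrightarrow> 0) (at t)"
      by (rule Lim_null_comparison[rotated]) (simp add: K)
    then show ?thesis by (simp add: LIM_zero_iff)
  qed
  then show ?thesis by (simp add: continuous_on_eq_continuous_at isCont_def)
qed

lemma holder_norm_bounds:
  assumes "0 < r" "periodic f" "holder_continuous r f"
  shows "0 \<le> holder_norm r f" "\<bar>f s - f t\<bar> \<le> holder_norm r f * \<bar>s - t\<bar> powr r"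
proof -
  obtain K where K: "\<And>s t. \<bar>f s - f t\<bar> \<le> K * \<bar>s - t\<bar> powr r"
    using assms(3) by (auto simp: holder_continuous_def)
  have C0: "0 \<le> C0_norm f"
    using abs_le_C0_norm[OF assms(2) holder_continuous_imp_continuous[OF assms(1,3)], of 0] by linarith
  have q: "\<bar>f s - f t\<bar> / \<bar>s - t\<bar> powr r \<le> holder_seminorm r f" if "s \<noteq> t" for s t
  proof -
    have "bdd_above ((\<lambda>(s, t). \<bar>f s - f t\<bar> / \<bar>s - t\<bar> powr r) ` {(s, t). s \<noteq> t})"
      using K by (intro bdd_aboveI2[where M = K]) (auto simp: divide_le_eq)
    then show ?thesis
      unfolding holder_seminorm_def using that
      by (intro cSUP_upper2[where x = "(s, t)"]) auto
  qed
  have "0 \<le> \<bar>f 1 - f 0\<bar> / \<bar>1 - 0\<bar> powr r" by simp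
  then have sn: "0 \<le> holder_seminorm r f" using q[of 1 0] by linarith
  then show "0 \<le> holder_norm r f" using C0 by (simp add: holder_norm_def)
  show "\<bar>f s - f t\<bar> \<le> holder_norm r f * \<bar>s - t\<bar> powr r"
  proof (cases "s = t")
    case False
    then have "\<bar>f s - f t\<bar> \<le> holder_seminorm r f * \<bar>s - t\<bar> powr r"
      using q[of s t] by (simp add: divide_le_eq)
    also have "\<dots> \<le> holder_norm r f * \<bar>s - t\<bar> powr r"
      using C0 by (intro mult_right_mono) (auto simp: holder_norm_def)
    finally show ?thesis .
  qed simp
qed

text \<open>
  A Hoelder continuous phase shift is not differentiable, so it is replaced by its average over
  \<open>[t, t + h]\<close>.  The two error terms balance at \<open>h = 1 / A\<close>: the flow, of gradient of order \<open>A\<close>, changes by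
  \<open>A h powr r\<close> and the averaged shift moves with speed \<open>h powr (r - 1)\<close>, both of order
  \<open>A powr (1 - r)\<close>.
\<close>

lemma steklov_mean:
  fixes f :: "real \<Rightarrow> real"
  assumes h: "0 < h" and r: "0 < r" and K: "0 \<le> K" and cont: "continuous_on UNIV f"
    and hol: "\<And>s t. \<bar>f s - f t\<bar> \<le> K * \<bar>s - t\<bar> powr r"
  obtains m m' where "\<And>t. (m has_real_derivative m' t) (at t)" "continuous_on UNIV m'"
    "\<And>t. \<bar>m t - f t\<bar> \<le> K * h powr r" "\<And>t. \<bar>m' t\<bar> \<le> K * h powr (r - 1)"
proof -
  obtain F where F: "\<And>x. (F has_real_derivative f x) (at x)" using antiderivative_ex[OF cont] by blast
  define m where "m t = (F (t + h) - F t) / h" for t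
  define m' where "m' t = (f (t + h) - f t) / h" for t
  show ?thesis
  proof
    show "(m has_real_derivative m' t) (at t)" for t
    proof -
      have "((\<lambda>t. F (t + h)) has_real_derivative f (t + h)) (at t)"
        using F[of "t + h"] by (simp only: DERIV_shift)
      then show ?thesis unfolding m_def m'_def using F h by (auto intro!: derivative_eq_intros)
    qed
    show "continuous_on UNIV m'"
      unfolding m'_def using h
      by (intro continuous_intros cont continuous_on_compose2[OF cont]) auto
    show "\<bar>m t - f t\<bar> \<le> K * h powr r" for t
    proof -
      obtain z where z: "t < z" "z < t + h" "F (t + h) - F t = (t + h - t) * f z"
        using MVT2[of t "t + h" F f] h F by auto
      have "\<bar>m t - f t\<bar> = \<bar>f z - f t\<bar>" using z(3) h by (simp add: m_def)
      also have "\<dots> \<le> K * \<bar>z - t\<bar> powr r" by (rule hol)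
      also have "\<dots> \<le> K * h powr r" using z r K by (intro mult_left_mono powr_mono2) auto
      finally show ?thesis .
    qed
    show "\<bar>m' t\<bar> \<le> K * h powr (r - 1)" for t
    proof -
      have "\<bar>f (t + h) - f t\<bar> \<le> K * h powr r" using hol[of "t + h" t] h by simp
      then show ?thesis using h by (simp add: m'_def powr_diff divide_right_mono)
    qed
  qed
qed

section \<open>The one-dimensional profile\<close>

text \<open>
  \<open>1 / k\<close> is the speed, up to a factor, with which a particle can cross the point \<open>y\<close> of the cell
  in one coordinate direction: the flow contributes \<open>A |sin (2 \<pi> y)|\<close>, the unit burning speed and
  the motion of the cell together \<open>A powr (1 - r)\<close>.  Its antiderivative \<open>g\<close> is the travel time, and
  \<open>\<kappa>\<close> is the time needed for one period.  The logarithm is the time lost near the cell boundary \<open>y = 0\<close>: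
  there \<open>1 / k \<le> A powr (1 - r) + 2 \<pi> A y\<close>, and the integral of the reciprocal of this bound over \<open>[0, 1]\<close> is
  \<open>ln (1 + 2 \<pi> A powr r) / (2 \<pi> A)\<close>.
\<close>

lemma travel_time_profile:
  fixes r A :: real
  assumes A: "1 < A" and r: "0 < r"
  obtains g k \<kappa> B where
    "\<And>y. (g has_real_derivative k y) (at y)" "continuous_on UNIV k"
    "\<And>y. k y * (A powr (1 - r) + A * \<bar>sin (2 * pi * y)\<bar>) = 1" "\<And>y. 0 < k y"
    "r * ln A / (2 * pi * A) \<le> \<kappa>" "\<And>y. \<bar>g y - \<kappa> * y\<bar> \<le> B"
proof -
  define k where "k y = 1 / (A powr (1 - r) + A * \<bar>sin (2 * pi * y)\<bar>)" for y
  have den: "0 < A powr (1 - r) + A * \<bar>sin (2 * pi * y)\<bar>" for y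
    using A by (intro add_pos_nonneg) auto
  have contk: "continuous_on UNIV k"
    unfolding k_def using den by (intro continuous_intros) (simp add: less_imp_neq[symmetric])
  obtain g where g: "\<And>y. (g has_real_derivative k y) (at y)" using antiderivative_ex[OF contk] by blast
  have kper: "k (y + 1) = k y" for y by (simp add: k_def distrib_left sin_add)
  define \<kappa> where "\<kappa> = g 1 - g 0"
  have gshift: "g (y + 1) = g y + \<kappa>" for y
  proof -
    have "((\<lambda>y. g (y + 1) - g y) has_real_derivative 0) (at y)" for y
    proof -
      have "((\<lambda>y. g (y + 1)) has_real_derivative k y) (at y)"
        using g[of "y + 1"] by (simp only: DERIV_shift kper)
      then show ?thesis using g by (auto intro!: derivative_eq_intros)
    qed
    then have "g (y + 1) - g y = g (0 + 1) - g 0"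
      using DERIV_isconst_all[of "\<lambda>y. g (y + 1) - g y" y 0] by blast
    then show ?thesis by (simp add: \<kappa>_def)
  qed
  have "periodic (\<lambda>y. g y - \<kappa> * y)"
    unfolding periodic_def periodic_fun_simple_def
    by (rule exI[of _ 1]) (auto simp: algebra_simps gshift)
  moreover have "continuous_on UNIV (\<lambda>y. g y - \<kappa> * y)"
    using g by (intro continuous_intros continuous_at_imp_continuous_on) (auto intro: DERIV_isCont)
  ultimately obtain B where B: "\<And>y. \<bar>g y - \<kappa> * y\<bar> \<le> B" using periodic_continuous_bounded by blast
  \<comment> \<open>an antiderivative of the lower bound \<open>1 / (A powr (1 - r) + 2 \<pi> A y)\<close> of \<open>k\<close>\<close>
  define \<Lambda> where "\<Lambda> y = ln (A powr (1 - r) + 2 * pi * A * y) / (2 * pi * A)" for y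
  have "g 0 - \<Lambda> 0 \<le> g 1 - \<Lambda> 1"
  proof (rule DERIV_nonneg_imp_nondecreasing[where f = "\<lambda>y. g y - \<Lambda> y"])
    fix y :: real assume y: "0 \<le> y" "y \<le> 1"
    have p: "0 < A powr (1 - r) + 2 * pi * A * y" using A y by (intro add_pos_nonneg) auto
    have "(\<Lambda> has_real_derivative 1 / (A powr (1 - r) + 2 * pi * A * y)) (at y)"
      unfolding \<Lambda>_def using p A by (auto intro!: derivative_eq_intros simp: divide_simps)
    then have "((\<lambda>y. g y - \<Lambda> y) has_real_derivative k y - 1 / (A powr (1 - r) + 2 * pi * A * y)) (at y)"
      using g by (intro derivative_intros)
    moreover have "1 / (A powr (1 - r) + 2 * pi * A * y) \<le> k y"
    proof -
      have "\<bar>sin (2 * pi * y)\<bar> \<le> 2 * pi * y" using abs_sin_x_le_abs_x[of "2 * pi * y"] y by simp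
      then have "A * \<bar>sin (2 * pi * y)\<bar> \<le> A * (2 * pi * y)" using A by (intro mult_left_mono) auto
      then show ?thesis unfolding k_def by (intro divide_left_mono mult_pos_pos den p) (auto simp: mult_ac)
    qed
    ultimately show "\<exists>d. ((\<lambda>y. g y - \<Lambda> y) has_real_derivative d) (at y) \<and> 0 \<le> d" by auto
  qed simp
  moreover have "r * ln A / (2 * pi * A) \<le> \<Lambda> 1 - \<Lambda> 0"
  proof -
    have "ln A \<le> ln (A powr (1 - r) + 2 * pi * A)"
    proof -
      have "A * 1 \<le> A * (2 * pi)" using A pi_gt3 by (intro mult_left_mono) auto
      then have "A \<le> A powr (1 - r) + 2 * pi * A" using powr_ge_zero[of A "1 - r"] unfolding mult.commute[of A "2 * pi"] by linarith
      then show ?thesis using A by (intro ln_mono) auto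
    qed
    then have "r * ln A \<le> ln (A powr (1 - r) + 2 * pi * A) - ln (A powr (1 - r))"
      using A by (simp add: ln_powr algebra_simps)
    then have "r * ln A / (2 * pi * A) \<le> (ln (A powr (1 - r) + 2 * pi * A) - ln (A powr (1 - r))) / (2 * pi * A)"
      using A by (intro divide_right_mono) auto
    then show ?thesis by (simp add: \<Lambda>_def diff_divide_distrib)
  qed
  ultimately have "r * ln A / (2 * pi * A) \<le> \<kappa>" by (simp add: \<kappa>_def)
  moreover have "k y * (A powr (1 - r) + A * \<bar>sin (2 * pi * y)\<bar>) = 1" for y
    using den[of y] by (simp add: k_def)
  moreover have "0 < k y" for y using den[of y] by (simp add: k_def)
  ultimately show ?thesis using that g contk B by blast
qed

section \<open>The cellular flow\<close>

lemma stream_flow_cellular: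
  "stream_flow (cellular_stream U \<alpha> \<beta>) x t =
     vector [- 2 * pi * U t * sin (2 * pi * (x $ 1 + \<alpha> t)) * cos (2 * pi * (x $ 2 + \<beta> t)),
               2 * pi * U t * cos (2 * pi * (x $ 1 + \<alpha> t)) * sin (2 * pi * (x $ 2 + \<beta> t))]"
proof -
  have "((\<lambda>y. cellular_stream U \<alpha> \<beta> y t) has_derivative
      (\<lambda>h. 2 * pi * U t * (cos (2 * pi * (x $ 1 + \<alpha> t)) * sin (2 * pi * (x $ 2 + \<beta> t)) * h $ 1
         + sin (2 * pi * (x $ 1 + \<alpha> t)) * cos (2 * pi * (x $ 2 + \<beta> t)) * h $ 2))) (at x)"
    unfolding cellular_stream_def
    by (auto intro!: derivative_eq_intros bounded_linear_imp_has_derivative bounded_linear_vec_nth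
          simp: algebra_simps)
  from frechet_derivative_at[OF this, symmetric] show ?thesis
    by (simp add: stream_flow_def partial_deriv_def axis_def vec_eq_iff forall_2 vector_2)
qed


text \<open>
  The line \<open>x $ 1 = k / 2 - \<alpha> t\<close> bounds a column of cells, and there the first component of the flow
  vanishes; the same holds for the rows and the second component.  Each component is thus controlled
  by its own coordinate alone, so the two coordinates decouple.
\<close>

lemma cellular_flow_component_le:
  assumes "\<bar>U t\<bar> \<le> M"
  shows "\<bar>stream_flow (cellular_stream U \<alpha> \<beta>) x t $ 1\<bar> \<le> 2 * pi * M * \<bar>sin (2 * pi * (x $ 1 + \<alpha> t))\<bar>"
    and "\<bar>stream_flow (cellular_stream U \<alpha> \<beta>) x t $ 2\<bar> \<le> 2 * pi * M * \<bar>sin (2 * pi * (x $ 2 + \<beta> t))\<bar>"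
proof -
  have aux: "2 * pi * \<bar>U t\<bar> * \<bar>sin y\<bar> * \<bar>cos y'\<bar> \<le> 2 * pi * M * \<bar>sin y\<bar>" for y y'
  proof -
    have "2 * pi * \<bar>U t\<bar> * \<bar>sin y\<bar> * \<bar>cos y'\<bar> \<le> 2 * pi * M * \<bar>sin y\<bar> * 1"
      using assms by (intro mult_mono) auto
    then show ?thesis by simp
  qed
  show "\<bar>stream_flow (cellular_stream U \<alpha> \<beta>) x t $ 1\<bar> \<le> 2 * pi * M * \<bar>sin (2 * pi * (x $ 1 + \<alpha> t))\<bar>"
    using aux by (simp add: stream_flow_cellular abs_mult)
  show "\<bar>stream_flow (cellular_stream U \<alpha> \<beta>) x t $ 2\<bar> \<le> 2 * pi * M * \<bar>sin (2 * pi * (x $ 2 + \<beta> t))\<bar>"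
    using aux[of "2 * pi * (x $ 2 + \<beta> t)" "2 * pi * (x $ 1 + \<alpha> t)"]
    by (simp add: stream_flow_cellular abs_mult mult_ac)
qed

section \<open>The bound on the flame speed\<close>

lemma sin_lipschitz: "\<bar>sin x - sin y\<bar> \<le> \<bar>x - y\<bar>" for x y :: real
proof -
  have "\<bar>sin x - sin y\<bar> = 2 * \<bar>sin ((x - y) / 2)\<bar> * \<bar>cos ((x + y) / 2)\<bar>"
    by (simp add: sin_diff_sin abs_mult)
  also have "\<dots> \<le> 2 * \<bar>(x - y) / 2\<bar> * 1"
    by (intro mult_mono mult_left_mono abs_sin_x_le_abs_x) auto
  finally show ?thesis by simp
qed

text \<open>
  Here \<open>a\<close> is the true phase shift, \<open>m\<close> its average, \<open>m'\<close> the speed of the average, and \<open>q\<close> is \<open>k\<close> at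
  \<open>x + m\<close>.  The first factor bounds how fast a particle moves relative to the averaged cells.
  Replacing \<open>a\<close> by \<open>m\<close> in the sine costs a multiple of \<open>A * A powr - r\<close>, which the term
  \<open>A powr (1 - r)\<close> in \<open>1 / q\<close> absorbs; it also absorbs the speed \<open>m'\<close>
  and, since \<open>A > 1\<close> and \<open>r \<le> 1\<close>, the burning speed \<open>1\<close>.
\<close>

lemma relative_speed_times_profile_le:
  fixes A r K M x a m m' q D :: real
  assumes A: "1 < A" and r: "0 < r" "r \<le> 1" and K: "0 \<le> K" and M: "0 \<le> M"
    and m: "\<bar>m - a\<bar> \<le> K * A powr - r" and m': "\<bar>m'\<bar> \<le> K * A powr (1 - r)"
    and q: "0 \<le> q" "q * (A powr (1 - r) + A * \<bar>sin (2 * pi * (x + m))\<bar>) = 1"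
    and D: "1 + K + 2 * pi * M + 4 * pi\<^sup>2 * M * K \<le> D"
  shows "(\<bar>m'\<bar> + A * (2 * pi * M * \<bar>sin (2 * pi * (x + a))\<bar>) + 1) * q \<le> D"
proof -
  define W where "W = A powr (1 - r)"
  define S where "S = \<bar>sin (2 * pi * (x + m))\<bar>"
  have W1: "1 \<le> W" using A r by (simp add: W_def ge_one_powr_ge_zero)
  have AW: "A * A powr - r = W" using A by (simp add: W_def powr_diff powr_minus divide_simps)
  have S0: "0 \<le> A * S" using A by (simp add: S_def)
  have "\<bar>sin (2 * pi * (x + a))\<bar> \<le> S + 2 * pi * (K * A powr - r)"
  proof -
    have "\<bar>sin (2 * pi * (x + a)) - sin (2 * pi * (x + m))\<bar> \<le> \<bar>2 * pi * (x + a) - 2 * pi * (x + m)\<bar>"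
      by (rule sin_lipschitz)
    also have "\<dots> = 2 * pi * \<bar>m - a\<bar>" by (simp add: abs_mult right_diff_distrib[symmetric])
    also have "\<dots> \<le> 2 * pi * (K * A powr - r)" using m by (intro mult_left_mono) auto
    finally show ?thesis by (simp add: S_def)
  qed
  then have "A * (2 * pi * M * \<bar>sin (2 * pi * (x + a))\<bar>) \<le> A * (2 * pi * M * (S + 2 * pi * (K * A powr - r)))"
    using A M by (intro mult_left_mono) auto
  also have "\<dots> = 2 * pi * M * (A * S) + 4 * pi\<^sup>2 * M * K * (A * A powr - r)"
    by (simp add: algebra_simps power2_eq_square)
  finally have "\<bar>m'\<bar> + A * (2 * pi * M * \<bar>sin (2 * pi * (x + a))\<bar>) + 1
      \<le> K * W + (2 * pi * M * (A * S) + 4 * pi\<^sup>2 * M * K * W) + W"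
    using m' W1 unfolding AW W_def[symmetric] by linarith
  also have "\<dots> = (1 + K + 4 * pi\<^sup>2 * M * K) * W + (2 * pi * M) * (A * S)"
    by (simp add: algebra_simps)
  also have "\<dots> \<le> D * W + D * (A * S)"
  proof (intro add_mono mult_right_mono S0)
    have "0 \<le> 2 * pi * M" "0 \<le> 4 * pi\<^sup>2 * M * K" using M K by auto
    then show "1 + K + 4 * pi\<^sup>2 * M * K \<le> D" "2 * pi * M \<le> D" using D K by linarith+
  qed (use W1 in simp)
  finally have "(\<bar>m'\<bar> + A * (2 * pi * M * \<bar>sin (2 * pi * (x + a))\<bar>) + 1) * q \<le> (D * W + D * (A * S)) * q"
    using q(1) by (rule mult_right_mono)
  also have "\<dots> = D * (q * (W + A * S))" by (simp add: algebra_simps)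
  finally show ?thesis using q(2) by (simp add: W_def S_def)
qed

theorem theorem4p1:
  fixes r :: real
  assumes "0 < r" and "r \<le> 1"
  shows "\<exists>C :: real \<Rightarrow> real \<Rightarrow> real \<Rightarrow> real.
    \<forall>(U :: real \<Rightarrow> real) (\<alpha> :: real \<Rightarrow> real) (\<beta> :: real \<Rightarrow> real).
      periodic U \<and> continuous_on UNIV U \<and>
      periodic \<alpha> \<and> holder_continuous r \<alpha> \<and>
      periodic \<beta> \<and> holder_continuous r \<beta> \<longrightarrow>
      (\<forall>(A :: real) (p :: real^2) (s :: real).
        A > 1 \<and> norm p = 1 \<and>
        is_turbulent_flame_speed (stream_flow (cellular_stream U \<alpha> \<beta>)) A p s \<longrightarrow>
        s \<le> C (C0_norm U) (holder_norm r \<alpha>) (holder_norm r \<beta>) * A / ln A)"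
proof (rule exI[of _ "\<lambda>M a b. 4 * pi * (1 + (a + b) + 2 * pi * M + 4 * pi\<^sup>2 * M * (a + b)) / r"],
    intro allI impI, elim conjE)
  fix U \<alpha> \<beta> :: "real \<Rightarrow> real" and A s :: real and p :: "real^2"
  assume U: "periodic U" "continuous_on UNIV U"
    and \<alpha>: "periodic \<alpha>" "holder_continuous r \<alpha>"
    and \<beta>: "periodic \<beta>" "holder_continuous r \<beta>"
    and A: "1 < A" and p: "norm p = 1"
    and s: "is_turbulent_flame_speed (stream_flow (cellular_stream U \<alpha> \<beta>)) A p s"
  define V where "V = stream_flow (cellular_stream U \<alpha> \<beta>)"
  define M where "M = C0_norm U"
  define a where "a = holder_norm r \<alpha>"
  define b where "b = holder_norm r \<beta>"
  define D where "D = 1 + (a + b) + 2 * pi * M + 4 * pi\<^sup>2 * M * (a + b)"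
  have UM: "\<bar>U t\<bar> \<le> M" for t unfolding M_def by (rule abs_le_C0_norm[OF U])
  have M0: "0 \<le> M" using UM[of 0] by linarith
  note ha = holder_norm_bounds[OF assms(1) \<alpha>, folded a_def]
  note hb = holder_norm_bounds[OF assms(1) \<beta>, folded b_def]
  note conta = holder_continuous_imp_continuous[OF assms(1) \<alpha>(2)]
  note contb = holder_continuous_imp_continuous[OF assms(1) \<beta>(2)]
  have Da: "1 + a + 2 * pi * M + 4 * pi\<^sup>2 * M * a \<le> D" and Db: "1 + b + 2 * pi * M + 4 * pi\<^sup>2 * M * b \<le> D"
    and D0: "0 \<le> D"
    using M0 ha(1) hb(1) by (simp_all add: D_def distrib_left)
  \<comment> \<open>Averaging over \<open>h = 1 / A\<close> balances the two errors of the averaged shifts.\<close>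
  have hpow: "(1 / A) powr r = A powr - r" "(1 / A) powr (r - 1) = A powr (1 - r)"
    using A by (simp_all add: powr_divide powr_diff powr_minus divide_simps)
  obtain m1 m1' where m1: "\<And>t. (m1 has_real_derivative m1' t) (at t)" "continuous_on UNIV m1'"
      "\<And>t. \<bar>m1 t - \<alpha> t\<bar> \<le> a * A powr - r" "\<And>t. \<bar>m1' t\<bar> \<le> a * A powr (1 - r)"
    using steklov_mean[of "1 / A" r a \<alpha>] A assms(1) ha conta unfolding hpow by auto
  obtain m2 m2' where m2: "\<And>t. (m2 has_real_derivative m2' t) (at t)" "continuous_on UNIV m2'"
      "\<And>t. \<bar>m2 t - \<beta> t\<bar> \<le> b * A powr - r" "\<And>t. \<bar>m2' t\<bar> \<le> b * A powr (1 - r)"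
    using steklov_mean[of "1 / A" r b \<beta>] A assms(1) hb contb unfolding hpow by auto
  obtain g k \<kappa> B where g: "\<And>y. (g has_real_derivative k y) (at y)" and contk: "continuous_on UNIV k"
    and k: "\<And>y. k y * (A powr (1 - r) + A * \<bar>sin (2 * pi * y)\<bar>) = 1" and kpos: "\<And>y. 0 < k y"
    and \<kappa>: "r * ln A / (2 * pi * A) \<le> \<kappa>" and B: "\<And>y. \<bar>g y - \<kappa> * y\<bar> \<le> B"
    using travel_time_profile[OF A assms(1)] by blast
  have \<kappa>0: "0 < \<kappa>" using \<kappa> A assms(1) by (smt (verit) divide_pos_pos ln_gt_zero mult_pos_pos pi_gt_zero)
  have p1: "\<bar>p $ i\<bar> \<le> 1" for i using component_le_norm_cart[of p i] p by simp
  \<comment> \<open>The subsolution: in the rescaled travel time \<open>g / \<kappa>\<close>, which differs from the identity by a bounded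
    function, each coordinate of a particle moves with speed at most \<open>D / \<kappa>\<close>.  The shift \<open>c\<close> puts the
    initial values below \<open>p \<bullet> x\<close>.\<close>
  define \<sigma> where "\<sigma> = 2 * D / \<kappa>"
  define c where "c = 2 * (B / \<kappa>) + \<bar>m1 0\<bar> + \<bar>m2 0\<bar>"
  define w :: "spacetime \<Rightarrow> real" where "w z = p $ 1 / \<kappa> * g (fst z $ 1 + m1 (snd z))
      + p $ 2 / \<kappa> * g (fst z $ 2 + m2 (snd z)) - \<sigma> * snd z - c" for z
  define d1 where "d1 z = p $ 1 / \<kappa> * k (fst z $ 1 + m1 (snd z))" for z :: spacetime
  define d2 where "d2 z = p $ 2 / \<kappa> * k (fst z $ 2 + m2 (snd z))" for z :: spacetime
  define Dw where "Dw z = (d1 z *\<^sub>R axis 1 1 + d2 z *\<^sub>R axis 2 1 :: real^2,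
      d1 z * m1' (snd z) + d2 z * m2' (snd z) - \<sigma>)" for z
  have cont_m: "continuous_on X m1" "continuous_on X m2" for X
    using m1(1) m2(1) by (auto intro!: continuous_at_imp_continuous_on DERIV_isCont)
  have dw: "GDERIV w z :> Dw z" for z
  proof -
    have part: "((\<lambda>z. g (fst z $ i + m (snd z))) has_derivative
        (\<lambda>h. (fst h $ i + snd h * m' (snd z)) * k (fst z $ i + m (snd z)))) (at z)"
      if "\<And>t. (m has_real_derivative m' t) (at t)" for i :: 2 and m m' :: "real \<Rightarrow> real"
    proof -
      have 1: "((\<lambda>z. m (snd z)) has_derivative (\<lambda>h. snd h * m' (snd z))) (at z)"
        using has_derivative_compose[OF has_derivative_snd[OF has_derivative_ident]
            that[of "snd z", unfolded has_field_derivative_def]]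
        by (simp add: mult.commute)
      have 2: "((\<lambda>z. fst z $ i) has_derivative (\<lambda>h. fst h $ i)) (at z)"
        by (intro bounded_linear_imp_has_derivative bounded_linear_compose[OF bounded_linear_vec_nth] bounded_linear_fst)
      show ?thesis
        using has_derivative_compose[OF has_derivative_add[OF 2 1] g[unfolded has_field_derivative_def]]
        by (simp add: mult.commute)
    qed
    have "(w has_derivative (\<lambda>h. p $ 1 / \<kappa> * ((fst h $ 1 + snd h * m1' (snd z)) * k (fst z $ 1 + m1 (snd z)))
        + p $ 2 / \<kappa> * ((fst h $ 2 + snd h * m2' (snd z)) * k (fst z $ 2 + m2 (snd z))) - \<sigma> * snd h - 0)) (at z)"
      unfolding w_def
      by (intro has_derivative_diff has_derivative_add has_derivative_mult_right part m1(1) m2(1)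
          has_derivative_snd has_derivative_ident has_derivative_const)
    then show ?thesis
      unfolding gderiv_def Dw_def d1_def d2_def
      by (simp add: inner_prod_def inner_add_right inner_axis algebra_simps)
  qed
  have "continuous_on UNIV Dw"
    unfolding Dw_def d1_def d2_def
    by (intro continuous_intros continuous_on_compose2[OF contk] continuous_on_compose2[OF m1(2)]
        continuous_on_compose2[OF m2(2)] continuous_on_compose2[OF cont_m(1)] continuous_on_compose2[OF cont_m(2)]) auto
  then have C1: "C1_on (UNIV \<times> {0<..}) w Dw"
    using dw by (auto simp: C1_on_def intro: continuous_on_subset)
  have contw: "continuous_on (UNIV \<times> {0..}) w"
    using dw unfolding gderiv_def by (blast intro: continuous_at_imp_continuous_on has_derivative_continuous)
  note V1 = cellular_flow_component_le(1)[where U = U, OF UM, of \<alpha> \<beta>, folded V_def]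
  note V2 = cellular_flow_component_le(2)[where U = U, OF UM, of \<alpha> \<beta>, folded V_def]
  have Vnorm: "norm (V x t) \<le> 4 * pi * M" for x t
  proof -
    have "2 * pi * M * \<bar>sin y\<bar> \<le> 2 * pi * M" for y
      using M0 by (intro mult_right_le_one_le) auto
    then have "\<bar>V x t $ 1\<bar> \<le> 2 * pi * M" "\<bar>V x t $ 2\<bar> \<le> 2 * pi * M"
      by (rule order_trans[OF V1], rule order_trans[OF V2])
    then show ?thesis using norm_le_l1_cart[of "V x t"] by (simp add: sum_2)
  qed
  have sub: "G_operator V A z (Dw z) \<le> 0" for z
  proof -
    obtain x t where z: "z = (x, t)" by (cases z)
    \<comment> \<open>the contribution of one coordinate\<close>
    have part: "(d * m' + A * (v * d)) + \<bar>d\<bar> \<le> D / \<kappa>"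
      if d: "d = P / \<kappa> * q" "\<bar>P\<bar> \<le> 1" "0 < q" and v: "\<bar>v\<bar> \<le> 2 * pi * M * S"
        and est: "(\<bar>m'\<bar> + A * (2 * pi * M * S) + 1) * q \<le> D"
      for d m' v P q S :: real
    proof -
      have "\<bar>d\<bar> = \<bar>P\<bar> * q / \<kappa>" using d \<kappa>0 by (simp add: abs_mult)
      also have "\<dots> \<le> 1 * q / \<kappa>" using d \<kappa>0 by (intro divide_right_mono mult_right_mono) auto
      finally have dq: "\<bar>d\<bar> \<le> q / \<kappa>" by simp
      have S: "0 \<le> 2 * pi * M * S" using v by linarith
      have "d * m' \<le> \<bar>d\<bar> * \<bar>m'\<bar>" by (metis abs_ge_self abs_mult)
      moreover have "A * (v * d) \<le> A * (2 * pi * M * S * \<bar>d\<bar>)"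
      proof (rule mult_left_mono)
        have "v * d \<le> \<bar>v\<bar> * \<bar>d\<bar>" by (metis abs_ge_self abs_mult)
        also have "\<dots> \<le> 2 * pi * M * S * \<bar>d\<bar>" using v by (intro mult_right_mono) auto
        finally show "v * d \<le> 2 * pi * M * S * \<bar>d\<bar>" .
      qed (use A in simp)
      ultimately have "(d * m' + A * (v * d)) + \<bar>d\<bar> \<le> (\<bar>m'\<bar> + A * (2 * pi * M * S) + 1) * \<bar>d\<bar>"
        by (simp add: algebra_simps)
      also have "\<dots> \<le> (\<bar>m'\<bar> + A * (2 * pi * M * S) + 1) * (q / \<kappa>)"
        using S A by (intro mult_left_mono dq add_nonneg_nonneg mult_nonneg_nonneg[OF _ S]) auto
      also have "\<dots> \<le> D / \<kappa>" using est \<kappa>0 by (simp add: divide_right_mono)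
      finally show ?thesis .
    qed
    have e1: "(d1 z * m1' t + A * (V x t $ 1 * d1 z)) + \<bar>d1 z\<bar> \<le> D / \<kappa>"
      by (rule part[OF _ p1[of 1] kpos V1 relative_speed_times_profile_le[OF A assms ha(1) M0 m1(3,4) less_imp_le[OF kpos] k Da]])
         (simp add: d1_def z)
    have e2: "(d2 z * m2' t + A * (V x t $ 2 * d2 z)) + \<bar>d2 z\<bar> \<le> D / \<kappa>"
      by (rule part[OF _ p1[of 2] kpos V2 relative_speed_times_profile_le[OF A assms hb(1) M0 m2(3,4) less_imp_le[OF kpos] k Db]])
         (simp add: d2_def z)
    have "norm (fst (Dw z)) \<le> \<bar>d1 z\<bar> + \<bar>d2 z\<bar>"
      using norm_le_l1_cart[of "fst (Dw z)"] by (simp add: sum_2 Dw_def axis_def)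
    moreover have "A * (V x t \<bullet> fst (Dw z)) = A * (V x t $ 1 * d1 z) + A * (V x t $ 2 * d2 z)"
      by (simp add: Dw_def inner_add_right inner_axis distrib_left)
    moreover have "snd (Dw z) = d1 z * m1' t + d2 z * m2' t - \<sigma>" by (simp add: Dw_def z)
    ultimately have "snd (Dw z) + A * (V x t \<bullet> fst (Dw z)) + norm (fst (Dw z)) \<le> 2 * (D / \<kappa>) - \<sigma>"
      using e1 e2 by linarith
    then have "G_operator V A z (Dw z) \<le> 2 * (D / \<kappa>) - \<sigma>" by (simp add: G_operator_def z)
    then show ?thesis by (simp add: \<sigma>_def)
  qed
  \<comment> \<open>Up to bounded terms, \<open>w (x, t)\<close> is \<open>p \<bullet> x - \<sigma> t\<close>.\<close>
  have prof: "\<bar>P / \<kappa> * g y - P * y\<bar> \<le> B / \<kappa>" if "\<bar>P\<bar> \<le> 1" for P y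
  proof -
    have "P / \<kappa> * g y - P * y = P * (g y - \<kappa> * y) / \<kappa>" using \<kappa>0 by (simp add: field_simps)
    then have "\<bar>P / \<kappa> * g y - P * y\<bar> = \<bar>P\<bar> * \<bar>g y - \<kappa> * y\<bar> / \<kappa>" using \<kappa>0 by (simp add: abs_mult)
    also have "\<dots> \<le> 1 * B / \<kappa>" using that B[of y] \<kappa>0 by (intro divide_right_mono mult_mono) auto
    finally show ?thesis by simp
  qed
  have Pm: "\<bar>p $ i * m\<bar> \<le> \<bar>m\<bar>" for i m
    using p1[of i] by (simp add: abs_mult mult_left_le_one_le)
  from s obtain G where G: "solves_G_equation V A p G"
    and lim: "\<And>K. compact K \<Longrightarrow> uniform_limit K (\<lambda>t x. - G (x, t) / t) (\<lambda>_. s) at_top"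
    by (auto simp: is_turbulent_flame_speed_def V_def)
  have init: "w (x, 0) \<le> G (x, 0)" for x
  proof -
    have "G (x, 0) = p $ 1 * x $ 1 + p $ 2 * x $ 2"
      using G by (simp add: solves_G_equation_def inner_vec_def sum_2)
    then show ?thesis
      using prof[OF p1[of 1], of "x $ 1 + m1 0"] prof[OF p1[of 2], of "x $ 2 + m2 0"] Pm[of 1 "m1 0"] Pm[of 2 "m2 0"]
      unfolding w_def c_def distrib_left fst_conv snd_conv by linarith
  qed
  have wG: "w (0, t) \<le> G (0, t)" if "0 \<le> t" for t
    using G A that
    by (intro comparison_with_classical_subsolution[OF _ Vnorm _ _ C1 contw sub init])
       (auto simp: solves_G_equation_def)
  define E where "E = 2 * (B / \<kappa>) + (a * A powr - r + C0_norm \<alpha>) + (b * A powr - r + C0_norm \<beta>) + c"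
  have bound: "- G (0, t) / t \<le> \<sigma> + E / t" if t: "0 < t" for t
  proof -
    have "\<bar>m1 t\<bar> \<le> a * A powr - r + C0_norm \<alpha>" "\<bar>m2 t\<bar> \<le> b * A powr - r + C0_norm \<beta>"
      using m1(3)[of t] m2(3)[of t] abs_le_C0_norm[OF \<alpha>(1) conta, of t] abs_le_C0_norm[OF \<beta>(1) contb, of t]
      by linarith+
    then have "- \<sigma> * t - E \<le> w (0, t)"
      using prof[OF p1[of 1], of "m1 t"] prof[OF p1[of 2], of "m2 t"] Pm[of 1 "m1 t"] Pm[of 2 "m2 t"]
      unfolding w_def E_def fst_conv snd_conv by simp
    then have "- G (0, t) \<le> \<sigma> * t + E" using wG[of t] t by simp
    then show ?thesis using t by (simp add: divide_simps)
  qed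
  have "((\<lambda>t. - G (0, t) / t) \<longlongrightarrow> s) at_top"
    using tendsto_uniform_limitI[OF lim[of "{0}"]] by simp
  moreover have "((\<lambda>t. \<sigma> + E / t) \<longlongrightarrow> \<sigma> + 0) at_top"
    by (intro tendsto_intros tendsto_divide_0[OF tendsto_const] filterlim_at_top_imp_at_infinity filterlim_ident)
  moreover have "\<forall>\<^sub>F t in at_top. - G (0, t) / t \<le> \<sigma> + E / t"
    using eventually_gt_at_top[of 0] by eventually_elim (rule bound)
  ultimately have "s \<le> \<sigma> + 0" using tendsto_le[OF trivial_limit_at_top_linorder] by blast
  also have "\<dots> \<le> 2 * D / (r * ln A / (2 * pi * A))"
    using D0 \<kappa>0 A assms(1) unfolding add_0_right \<sigma>_def
    by (intro divide_left_mono \<kappa> mult_pos_pos divide_pos_pos) auto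
  also have "\<dots> = 4 * pi * D / r * A / ln A" by (simp add: divide_simps)
  finally show "s \<le> 4 * pi * (1 + (holder_norm r \<alpha> + holder_norm r \<beta>) + 2 * pi * C0_norm U
      + 4 * pi\<^sup>2 * C0_norm U * (holder_norm r \<alpha> + holder_norm r \<beta>)) / r * A / ln A"
    by (simp add: D_def a_def b_def M_def)
qed

end
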